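(* Let $A,B\in\mathbb{R}^{3\times 3}$ be symmetric matrices such that the pair $(A,B)$ is irreducible and satisfies the (CM) condition. Then the pair of quadratic forms $(Q_A,Q_B)$ is equivalent either to $(\xi_2^2\pm\xi_3^2,\ \xi_1^2\pm\xi_2^2)$ for some choice of the two signs, or to $(\xi_2\xi_3,\ \xi_1^2+\xi_2^2-\xi_3^2)$.
   Context: For a symmetric matrix $A\in\mathbb{R}^{3\times 3}$ write $Q_A(\xi)=\xi^\top A\xi$, $\xi=(\xi_1,\xi_2,\xi_3)\in\mathbb{R}^3$. A pair $(A,B)$ of symmetric real $3\times 3$ matrices is irreducible if $A$ and $B$ are linearly independent and $\ker(A)\cap\ker(B)=\{0\}$. Two irreducible pairs $(A,B)$ and $(\tilde A,\tilde B)$ (equivalently, the pairs of quadratic forms $(Q_A,Q_B)$ and $(Q_{\tilde A},Q_{\tilde B})$) are equivalent if there exist invertible matrices $M_1\in\mathbb{R}^{3\times 3}$ and $M_2\in\mathbb{R}^{2\times 2}$ such that $$(Q_{\tilde A}(\xi),Q_{\tilde B}(\xi))^\top=M_2\cdot(Q_A(M_1\xi),Q_B(M_1\xi))^\top\quad\text{for every }\xi\in\mathbb{R}^3.$$ The pair $(A,B)$ satisfies the (CM) condition if $$\int_{S^1}|\det(x_1A+x_2B)|^{-\gamma}\,d\sigma(x_1,x_2)<\infty\quad\text{for all }0<\gamma<\tfrac23,$$ where $\sigma$ is arc length measure on the unit circle $S^1\subset\mathbb{R}^2$. The two signs $\pm$ in $(\xi_2^2\pm\xi_3^2,\xi_1^2\pm\xi_2^2)$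 are chosen independently. *)

theory Defs
  imports "HOL-Analysis.Analysis"
begin

definition quad_form :: "real^3^3 \<Rightarrow> real^3 \<Rightarrow> real" where
  "quad_form A \<xi> = \<xi> \<bullet> (A *v \<xi>)"

(* The conjunct A \<noteq> B is needed because {A, B} collapses to a singleton when A = B,
   whereas linear independence of the pair (A, B) is meant. *)
definition irreducible_pair :: "real^3^3 \<Rightarrow> real^3^3 \<Rightarrow> bool" where
  "irreducible_pair A B \<longleftrightarrow>
     transpose A = A \<and> transpose B = B \<and>
     A \<noteq> B \<and> independent {A, B} \<and>
     {x. A *v x = 0} \<inter> {x. B *v x = 0} = {0}"

definition equivalent_pairs ::
  "real^3^3 \<Rightarrow> real^3^3 \<Rightarrow> real^3^3 \<Rightarrow> real^3^3 \<Rightarrow> bool" where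
  "equivalent_pairs A B A' B' \<longleftrightarrow>
     irreducible_pair A B \<and> irreducible_pair A' B' \<and>
     (\<exists>(M1 :: real^3^3) (M2 :: real^2^2). invertible M1 \<and> invertible M2 \<and>
        (\<forall>\<xi>. (vector [quad_form A' \<xi>, quad_form B' \<xi>] :: real^2) =
              M2 *v vector [quad_form A (M1 *v \<xi>), quad_form B (M1 *v \<xi>)]))"

(* Equivalence of pairs of quadratic forms, given as functions, is equivalence of the pairs of
   symmetric matrices representing them; these matrices are uniquely determined by the forms. *)
definition equivalent_forms ::
  "(real^3 \<Rightarrow> real) \<Rightarrow> (real^3 \<Rightarrow> real) \<Rightarrow> (real^3 \<Rightarrow> real) \<Rightarrow> (real^3 \<Rightarrow> real) \<Rightarrow> bool" where
  "equivalent_forms P Q P' Q' \<longleftrightarrow>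
     (\<exists>A B A' B'. P = quad_form A \<and> Q = quad_form B \<and>
        P' = quad_form A' \<and> Q' = quad_form B' \<and> equivalent_pairs A B A' B')"

(* Arc length on the unit circle, as the push-forward of Lebesgue measure under the
   unit-speed parametrisation. *)
definition arc_length_S1 :: "(real^2) measure" where
  "arc_length_S1 =
     distr (restrict_space lborel {0..<2 * pi}) borel (\<lambda>t. vector [cos t, sin t])"

(* distr is only meaningful for a measurable map. *)
lemma measurable_circle_param:
  "(\<lambda>t. vector [cos t, sin t] :: real^2) \<in> borel_measurable (restrict_space lborel {0..<2 * pi})"
proof -
  have "continuous_on UNIV (\<lambda>t. vector [cos t, sin t] :: real^2)"
    by (subst continuous_on_componentwise)
       (auto simp: Basis_vec_def inner_axis forall_2 intro!: continuous_intros)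
  then show ?thesis
    by (intro measurable_restrict_space1)
       (simp add: borel_measurable_continuous_onI)
qed

lemma emeasure_arc_length_S1: "emeasure arc_length_S1 (sphere 0 1) = ennreal (2 * pi)"
proof -
  have n: "norm (vector [cos t, sin t] :: real^2) = 1" for t :: real
    by (simp add: norm_eq_sqrt_inner inner_vec_def sum_2 flip: power2_eq_square)
  show ?thesis
    unfolding arc_length_S1_def
    by (subst emeasure_distr[OF measurable_circle_param])
       (simp_all add: n space_restrict_space emeasure_restrict_space vimage_def)
qed

(* The integrand |det(x_1 A + x_2 B)|^(-\<gamma>) takes the value infinity where the determinant
   vanishes; this has to be spelled out because 0 powr (-\<gamma>) = 0. *)
definition CM_condition :: "real^3^3 \<Rightarrow> real^3^3 \<Rightarrow> bool" where
  "CM_condition A B \<longleftrightarrow>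
     (\<forall>\<gamma>::real. 0 < \<gamma> \<and> \<gamma> < 2/3 \<longrightarrow>
        (\<integral>\<^sup>+x. (let d = det (x$1 *\<^sub>R A + x$2 *\<^sub>R B)
               in if d = 0 then \<infinity> else ennreal (\<bar>d\<bar> powr (-\<gamma>))) \<partial>arc_length_S1) < \<infinity>)"

end

theory Submission
  imports Defs "HOL-Library.Quadratic_Discriminant"
begin

text \<open>
  The (CM) condition says that the binary cubic \<open>det (x A + y B)\<close> has no multiple root. Being of
  odd degree, it vanishes at some real member \<open>C\<close> of the pencil. Let \<open>v\<close> span a line in the kernel
  of \<open>C\<close>, and let \<open>D\<close> be a second member. Because the root is simple, \<open>Q\<^sub>D(v) \<noteq> 0\<close>, so \<open>D\<close> splits off
  \<open>v\<close> orthogonally and one is left with a pencil of symmetric \<open>2 \<times> 2\<close> blocks whose determinant is a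
  binary quadratic form with nonzero discriminant. If the discriminant is positive, two members of the
  pencil have rank one blocks and the pair is simultaneously diagonalisable; if it is negative, the
  block of \<open>C\<close> is a product of two independent linear forms, and in these coordinates \<open>D\<close> becomes
  diagonal, modulo \<open>C\<close>, with opposite signs in the block. Rescaling gives the normal forms.
\<close>

section \<open>Congruence and change of basis for pencils of symmetric matrices\<close>

definition sym3 :: "real \<Rightarrow> real \<Rightarrow> real \<Rightarrow> real \<Rightarrow> real \<Rightarrow> real \<Rightarrow> real^3^3" where
  "sym3 a b c d e f = vector [vector [a, b, c], vector [b, d, e], vector [c, e, f]]"

text \<open>The matrix form of equivalence: \<open>M\<close> is the substitution of variables and
  \<open>a\<close>, \<open>b\<close>, \<open>c\<close>, \<open>d\<close> are the entries of the 2x2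
  matrix acting on the pair. Irreducibility is left out, so that reductions can be chained without
  rechecking it for intermediate pairs.\<close>

definition pencil_equiv :: "real^3^3 \<Rightarrow> real^3^3 \<Rightarrow> real^3^3 \<Rightarrow> real^3^3 \<Rightarrow> bool" where
  "pencil_equiv A B A' B' \<longleftrightarrow>
     (\<exists>M a b c d. invertible M \<and> a * d - b * c \<noteq> 0 \<and>
        A' = transpose M ** (a *\<^sub>R A + b *\<^sub>R B) ** M \<and>
        B' = transpose M ** (c *\<^sub>R A + d *\<^sub>R B) ** M)"

text \<open>The binary cubic form \<open>det (x A + y B)\<close> is nonzero and has no multiple linear factor:
  in no basis of the pencil is it divisible by \<open>y\<^sup>2\<close>.\<close>
definition no_double_root :: "real^3^3 \<Rightarrow> real^3^3 \<Rightarrow> bool" where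
  "no_double_root A B \<longleftrightarrow>
     (\<forall>a b c d e f. a * d - b * c \<noteq> 0 \<longrightarrow>
        (\<exists>x y. det (x *\<^sub>R (a *\<^sub>R A + b *\<^sub>R B) + y *\<^sub>R (c *\<^sub>R A + d *\<^sub>R B))
                 \<noteq> y\<^sup>2 * (e * x + f * y)))"

lemmas matrix3_entrywise = vec_eq_iff forall_3 matrix_matrix_mult_def transpose_def sum_3

lemma congruence_add_scaleR:
  fixes A B M :: "real^3^3"
  shows "transpose M ** (a *\<^sub>R A + b *\<^sub>R B) ** M
       = a *\<^sub>R (transpose M ** A ** M) + b *\<^sub>R (transpose M ** B ** M)"
  by (simp add: vec_eq_iff matrix_matrix_mult_def forall_3 sum_3 algebra_simps)

lemma pencil_equiv_trans:
  assumes "pencil_equiv A B A' B'" "pencil_equiv A' B' A'' B''"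
  shows "pencil_equiv A B A'' B''"
proof -
  obtain M a b c d where M: "invertible M" "a * d - b * c \<noteq> 0"
      "A' = transpose M ** (a *\<^sub>R A + b *\<^sub>R B) ** M" "B' = transpose M ** (c *\<^sub>R A + d *\<^sub>R B) ** M"
    using assms(1) unfolding pencil_equiv_def by blast
  obtain N p q r s where N: "invertible N" "p * s - q * r \<noteq> 0"
      "A'' = transpose N ** (p *\<^sub>R A' + q *\<^sub>R B') ** N" "B'' = transpose N ** (r *\<^sub>R A' + s *\<^sub>R B') ** N"
    using assms(2) unfolding pencil_equiv_def by blast
  have comb: "transpose N ** (p *\<^sub>R A' + q *\<^sub>R B') ** N =
      transpose (M ** N) ** ((p * a + q * c) *\<^sub>R A + (p * b + q * d) *\<^sub>R B) ** (M ** N)" for p q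
  proof -
    have "p *\<^sub>R A' + q *\<^sub>R B'
        = transpose M ** (p *\<^sub>R (a *\<^sub>R A + b *\<^sub>R B) + q *\<^sub>R (c *\<^sub>R A + d *\<^sub>R B)) ** M"
      by (simp only: M congruence_add_scaleR)
    moreover have "p *\<^sub>R (a *\<^sub>R A + b *\<^sub>R B) + q *\<^sub>R (c *\<^sub>R A + d *\<^sub>R B)
        = (p * a + q * c) *\<^sub>R A + (p * b + q * d) *\<^sub>R B"
      by (simp add: algebra_simps)
    ultimately show ?thesis
      by (simp add: matrix_transpose_mul matrix_mul_assoc)
  qed
  have "(p * a + q * c) * (r * b + s * d) - (p * b + q * d) * (r * a + s * c)
      = (p * s - q * r) * (a * d - b * c)"
    by (simp add: algebra_simps)
  with M(2) N(2) have "(p * a + q * c) * (r * b + s * d) - (p * b + q * d) * (r * a + s * c) \<noteq> 0"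
    by simp
  with M(1) N comb show ?thesis
    unfolding pencil_equiv_def by (metis invertible_mult)
qed

text \<open>A change of basis of the pencil is absorbed by the quantifier over all bases, and a
  congruence multiplies the cubic by the nonzero constant \<open>(det M)\<^sup>2\<close>, which is
  compensated by rescaling \<open>e\<close> and \<open>f\<close>.\<close>

lemma no_double_root_pencil_equiv:
  assumes "pencil_equiv A B A' B'" "no_double_root A B"
  shows "no_double_root A' B'"
  unfolding no_double_root_def
proof (intro allI impI)
  fix p q r s e f :: real
  assume pq: "p * s - q * r \<noteq> 0"
  obtain M a b c d where M: "invertible M" "a * d - b * c \<noteq> 0"
      "A' = transpose M ** (a *\<^sub>R A + b *\<^sub>R B) ** M" "B' = transpose M ** (c *\<^sub>R A + d *\<^sub>R B) ** M"
    using assms(1) unfolding pencil_equiv_def by blast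
  have m: "(det M)\<^sup>2 \<noteq> 0" using M(1) by (simp add: invertible_det_nz)
  have "(p * a + q * c) * (r * b + s * d) - (p * b + q * d) * (r * a + s * c)
      = (p * s - q * r) * (a * d - b * c)"
    by (simp add: algebra_simps)
  with pq M(2) have "(p * a + q * c) * (r * b + s * d) - (p * b + q * d) * (r * a + s * c) \<noteq> 0"
    by simp
  then obtain x y where xy:
    "det (x *\<^sub>R ((p * a + q * c) *\<^sub>R A + (p * b + q * d) *\<^sub>R B)
        + y *\<^sub>R ((r * a + s * c) *\<^sub>R A + (r * b + s * d) *\<^sub>R B))
      \<noteq> y\<^sup>2 * (e / (det M)\<^sup>2 * x + f / (det M)\<^sup>2 * y)" (is "det ?X \<noteq> _")
    using assms(2) unfolding no_double_root_def by blast
  have "x *\<^sub>R (p *\<^sub>R A' + q *\<^sub>R B') + y *\<^sub>R (r *\<^sub>R A' + s *\<^sub>R B')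
     = (x * p + y * r) *\<^sub>R A' + (x * q + y * s) *\<^sub>R B'"
    by (simp add: algebra_simps)
  also have "\<dots> = transpose M ** ((x * p + y * r) *\<^sub>R (a *\<^sub>R A + b *\<^sub>R B)
      + (x * q + y * s) *\<^sub>R (c *\<^sub>R A + d *\<^sub>R B)) ** M"
    by (simp only: M congruence_add_scaleR)
  also have "(x * p + y * r) *\<^sub>R (a *\<^sub>R A + b *\<^sub>R B) + (x * q + y * s) *\<^sub>R (c *\<^sub>R A + d *\<^sub>R B) = ?X"
    by (simp add: algebra_simps)
  finally have "det (x *\<^sub>R (p *\<^sub>R A' + q *\<^sub>R B') + y *\<^sub>R (r *\<^sub>R A' + s *\<^sub>R B')) = (det M)\<^sup>2 * det ?X"
    by (simp add: det_mul power2_eq_square)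
  moreover have "(det M)\<^sup>2 * (y\<^sup>2 * (e / (det M)\<^sup>2 * x + f / (det M)\<^sup>2 * y)) = y\<^sup>2 * (e * x + f * y)"
    using m by (simp add: field_simps)
  ultimately show "\<exists>x y. det (x *\<^sub>R (p *\<^sub>R A' + q *\<^sub>R B') + y *\<^sub>R (r *\<^sub>R A' + s *\<^sub>R B'))
      \<noteq> y\<^sup>2 * (e * x + f * y)"
    using xy m by (metis mult_left_cancel)
qed

section \<open>The integral in the (CM) condition near a multiple root\<close>

text \<open>The antiderivative \<open>k * ln (t - l)\<close> is unbounded at \<open>l\<close>, so
  the part of the integral away from \<open>l\<close> exceeds any candidate value
  \<open>c\<close>.\<close>

lemma nn_integral_inverse_diverges:
  fixes l r k :: real
  assumes "l < r" "k > 0"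
  shows "(\<integral>\<^sup>+t. ennreal (k / (t - l)) * indicator {l<..<r} t \<partial>lborel) = \<infinity>" (is "?I = \<infinity>")
proof (rule ccontr)
  assume "?I \<noteq> \<infinity>"
  then obtain c where c: "?I = ennreal c" "c \<ge> 0"
    by (cases ?I) auto
  define m where "m = (l + r) / 2"
  \<comment> \<open>Chosen so that the integral from \<open>l + \<epsilon>\<close> to
    \<open>m\<close> is exactly \<open>c + 1\<close>.\<close>
  define \<epsilon> where "\<epsilon> = (m - l) * exp (- (c + 1) / k)"
  have m: "l < m" "m < r" using assms by (auto simp: m_def)
  have e: "0 < \<epsilon>" "\<epsilon> \<le> m - l"
    using m assms c by (auto simp: \<epsilon>_def mult_le_cancel_left1 intro!: divide_nonpos_pos)
  have "c + 1 = k * ln (m - l) - k * ln (l + \<epsilon> - l)"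
    using m assms by (simp add: \<epsilon>_def ln_mult distrib_left)
  then have "ennreal (c + 1) = ennreal (k * ln (m - l) - k * ln (l + \<epsilon> - l))"
    by (rule arg_cong)
  also have "\<dots> = (\<integral>\<^sup>+t. ennreal (k / (t - l)) * indicator {l + \<epsilon>..m} t \<partial>lborel)"
    using e assms
    by (intro nn_integral_FTC_Icc[symmetric]) (auto intro!: derivative_eq_intros simp: field_simps)
  also have "\<dots> \<le> ?I"
    using e m by (intro nn_integral_mono) (auto simp: indicator_def)
  finally have "ennreal (c + 1) \<le> ennreal c" by (simp only: c)
  with c(2) show False by (simp del: ennreal_plus)
qed

text \<open>Already \<open>\<gamma> = 1/2\<close> suffices: near a double zero at angle \<open>\<theta>\<close> the determinant is
  \<open>O((t - \<theta>)\<^sup>2)\<close>, so the integrand is at least a multiple of \<open>1 / (t - \<theta>)\<close>.\<close>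
lemma CM_condition_imp_no_double_root:
  assumes "CM_condition A B"
  shows "no_double_root A B"
proof (rule ccontr)
  assume "\<not> no_double_root A B"
  then obtain a b c d e f where D: "a * d - b * c \<noteq> 0" and
    eq: "\<And>x y. det (x *\<^sub>R (a *\<^sub>R A + b *\<^sub>R B) + y *\<^sub>R (c *\<^sub>R A + d *\<^sub>R B)) = y\<^sup>2 * (e * x + f * y)"
    unfolding no_double_root_def by blast
  define \<Delta> where "\<Delta> = a * d - b * c"
  have \<Delta>: "\<Delta> \<noteq> 0" using D by (simp add: \<Delta>_def)
  define g where "g t = det (cos t *\<^sub>R A + sin t *\<^sub>R B)" for t
  \<comment> \<open>By Cramer's rule, \<open>\<alpha> t\<close> and \<open>\<beta> t\<close> are the
    coordinates of \<open>(cos t, sin t)\<close> in the basis \<open>(a, b)\<close>,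
    \<open>(c, d)\<close>.\<close>
  define \<alpha> where "\<alpha> t = (d * cos t - c * sin t) / \<Delta>" for t
  define \<beta> where "\<beta> t = (a * sin t - b * cos t) / \<Delta>" for t
  have g_eq: "g t = (\<beta> t)\<^sup>2 * (e * \<alpha> t + f * \<beta> t)" for t
  proof -
    have 1: "\<alpha> t * a + \<beta> t * c = cos t" "\<alpha> t * b + \<beta> t * d = sin t"
      using \<Delta> by (simp_all add: \<alpha>_def \<beta>_def divide_simps) (simp_all add: \<Delta>_def algebra_simps)
    have "\<alpha> t *\<^sub>R (a *\<^sub>R A + b *\<^sub>R B) + \<beta> t *\<^sub>R (c *\<^sub>R A + d *\<^sub>R B)
        = (\<alpha> t * a + \<beta> t * c) *\<^sub>R A + (\<alpha> t * b + \<beta> t * d) *\<^sub>R B"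
      by (simp add: algebra_simps)
    then show ?thesis unfolding 1 g_def using eq by metis
  qed
  \<comment> \<open>Polar coordinates of \<open>(a, b)\<close>: its angle \<theta> is a zero of
    \<beta>, hence the location of the double zero of \<open>g\<close>.\<close>
  define \<rho> where "\<rho> = sqrt (a\<^sup>2 + b\<^sup>2)"
  have "a\<^sup>2 + b\<^sup>2 \<noteq> 0" using D by (auto simp: sum_power2_eq_zero_iff)
  then have \<rho>: "\<rho> > 0" unfolding \<rho>_def by (smt (verit) real_sqrt_gt_zero sum_power2_ge_zero)
  have "(a / \<rho>)\<^sup>2 + (b / \<rho>)\<^sup>2 = 1"
    using \<rho> by (auto simp: power_divide \<rho>_def divide_simps)
  then obtain \<theta> where \<theta>: "0 \<le> \<theta>" "\<theta> < 2 * pi" "a / \<rho> = cos \<theta>" "b / \<rho> = sin \<theta>"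
    using sincos_total_2pi by metis
  have ab: "a = \<rho> * cos \<theta>" "b = \<rho> * sin \<theta>" using \<theta> \<rho> by (auto simp: field_simps)
  have \<beta>_eq: "\<beta> t = \<rho> / \<Delta> * sin (t - \<theta>)" for t
    by (simp add: \<beta>_def ab sin_diff diff_divide_distrib algebra_simps)
  define K where "K = \<bar>\<rho> / \<Delta>\<bar>"
  \<comment> \<open>\<open>L\<close> bounds the remaining linear factor; the summand 1 keeps it
    positive even when \<open>e\<close> and \<open>f\<close> both vanish, that is, when the cubic is
    identically zero.\<close>
  define L where "L = \<bar>e\<bar> * ((\<bar>d\<bar> + \<bar>c\<bar>) / \<bar>\<Delta>\<bar>) + \<bar>f\<bar> * K + 1"
  have K: "K > 0" using \<rho> \<Delta> by (simp add: K_def)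
  have L: "L > 0" using K by (simp add: L_def add_nonneg_pos)
  have \<beta>_le: "\<bar>\<beta> t\<bar> \<le> K * \<bar>t - \<theta>\<bar>" "\<bar>\<beta> t\<bar> \<le> K" for t
    unfolding \<beta>_eq abs_mult K_def[symmetric]
    using K abs_sin_le_one[of "t - \<theta>"] abs_sin_x_le_abs_x[of "t - \<theta>"] 
    by (auto intro: mult_left_mono simp: mult_le_cancel_left1)
  have \<alpha>_le: "\<bar>\<alpha> t\<bar> \<le> (\<bar>d\<bar> + \<bar>c\<bar>) / \<bar>\<Delta>\<bar>" for t
  proof -
    have "\<bar>d * cos t - c * sin t\<bar> \<le> \<bar>d\<bar> * \<bar>cos t\<bar> + \<bar>c\<bar> * \<bar>sin t\<bar>"
      by (metis abs_mult abs_triangle_ineq4)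
    also have "\<dots> \<le> \<bar>d\<bar> + \<bar>c\<bar>"
      by (intro add_mono mult_left_le) auto
    finally show ?thesis by (simp add: \<alpha>_def divide_right_mono)
  qed
  have g_le: "\<bar>g t\<bar> \<le> (K * \<bar>t - \<theta>\<bar>)\<^sup>2 * L" for t
  proof -
    have "\<bar>e * \<alpha> t + f * \<beta> t\<bar> \<le> \<bar>e\<bar> * \<bar>\<alpha> t\<bar> + \<bar>f\<bar> * \<bar>\<beta> t\<bar>"
      by (metis abs_mult abs_triangle_ineq)
    also have "\<dots> \<le> \<bar>e\<bar> * ((\<bar>d\<bar> + \<bar>c\<bar>) / \<bar>\<Delta>\<bar>) + \<bar>f\<bar> * K"
      by (intro add_mono mult_left_mono \<alpha>_le \<beta>_le) auto
    finally have 1: "\<bar>e * \<alpha> t + f * \<beta> t\<bar> \<le> L" by (simp add: L_def)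
    have "(\<beta> t)\<^sup>2 \<le> (K * \<bar>t - \<theta>\<bar>)\<^sup>2"
      using \<beta>_le(1)[of t] by (metis abs_ge_zero power2_abs power_mono)
    with 1 show ?thesis
      unfolding g_eq abs_mult by (intro mult_mono) auto
  qed
  define k where "k = 1 / (K * sqrt L)"
  have k: "k > 0" using K L by (simp add: k_def)
  \<comment> \<open>A one-sided comparison to the right of \<theta> is enough, and since \<theta> is
    below \<open>2 * pi\<close> this interval is nonempty and lies in the parameter range. Zeros of
    \<open>g\<close> cause no trouble, as the right-hand side is infinite there.\<close>
  have low: "ennreal (k / (t - \<theta>)) * indicator {\<theta><..<2 * pi} t
      \<le> (if g t = 0 then \<infinity> else ennreal (\<bar>g t\<bar> powr - (1/2))) * indicator {0..<2 * pi} t" for t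
  proof (cases "t \<in> {\<theta><..<2 * pi} \<and> g t \<noteq> 0")
    case True
    have "sqrt \<bar>g t\<bar> \<le> sqrt ((K * \<bar>t - \<theta>\<bar>)\<^sup>2 * L)" using g_le by (rule real_sqrt_le_mono)
    also have "\<dots> = K * (t - \<theta>) * sqrt L"
      using True K by (simp add: real_sqrt_mult)
    finally have "1 / (K * (t - \<theta>) * sqrt L) \<le> 1 / sqrt \<bar>g t\<bar>"
      using True K L by (intro divide_left_mono) auto
    then have "k / (t - \<theta>) \<le> \<bar>g t\<bar> powr - (1/2)"
      by (simp add: k_def powr_minus powr_half_sqrt divide_simps mult_ac)
    with True \<theta> show ?thesis by (auto simp: indicator_def intro: ennreal_leI)
  qed (use \<theta> in \<open>auto simp: indicator_def\<close>)
  have meas: "(\<lambda>x::real^2. let d = det (x$1 *\<^sub>R A + x$2 *\<^sub>R B)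
               in if d = 0 then \<infinity> else ennreal (\<bar>d\<bar> powr (-(1/2)))) \<in> borel_measurable borel"
  proof -
    have "continuous_on UNIV (\<lambda>x::real^2. det (x$1 *\<^sub>R A + x$2 *\<^sub>R B))"
      unfolding det_3 by (intro continuous_intros)
    then have [measurable]: "(\<lambda>x::real^2. det (x$1 *\<^sub>R A + x$2 *\<^sub>R B)) \<in> borel_measurable borel"
      by (rule borel_measurable_continuous_onI)
    show ?thesis unfolding Let_def by measurable
  qed
  have "\<infinity> = (\<integral>\<^sup>+t. ennreal (k / (t - \<theta>)) * indicator {\<theta><..<2 * pi} t \<partial>lborel)"
    using nn_integral_inverse_diverges[OF \<theta>(2) k] by simp
  also have "\<dots> \<le> (\<integral>\<^sup>+t. (if g t = 0 then \<infinity> else ennreal (\<bar>g t\<bar> powr - (1/2)))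
                          * indicator {0..<2 * pi} t \<partial>lborel)"
    by (intro nn_integral_mono low)
  also have "\<dots> = (\<integral>\<^sup>+x. (let d = det (x$1 *\<^sub>R A + x$2 *\<^sub>R B)
               in if d = 0 then \<infinity> else ennreal (\<bar>d\<bar> powr (-(1/2)))) \<partial>arc_length_S1)"
    unfolding arc_length_S1_def g_def
    by (subst nn_integral_distr[OF measurable_circle_param])
       (use meas in \<open>simp_all add: nn_integral_restrict_space Let_def\<close>)
  also have "\<dots> < \<infinity>"
    using assms[unfolded CM_condition_def, rule_format, of "1/2"] by simp
  finally show False by simp
qed

section \<open>Reduction to block form at a real root of the cubic\<close>

lemma pencil_equiv_I:
  assumes "det M \<noteq> 0" "a * d - b * c \<noteq> 0"
    "transpose M ** (a *\<^sub>R A + b *\<^sub>R B) ** M = A'"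
    "transpose M ** (c *\<^sub>R A + d *\<^sub>R B) ** M = B'"
  shows "pencil_equiv A B A' B'"
  using assms unfolding pencil_equiv_def by (metis invertible_det_nz)

lemma symmetric_entry:
  assumes "transpose A = A"
  shows "A$i$j = A$j$i"
  using assms by (metis transpose_def vec_lambda_beta)

lemma symmetric_eq_sym3:
  fixes A :: "real^3^3"
  assumes "transpose A = A"
  shows "A = sym3 (A$1$1) (A$1$2) (A$1$3) (A$2$2) (A$2$3) (A$3$3)"
proof -
  have "A$2$1 = A$1$2" "A$3$1 = A$1$3" "A$3$2 = A$2$3"
    using symmetric_entry[OF assms] by blast+
  then show ?thesis by (simp add: sym3_def vec_eq_iff forall_3)
qed

lemma sym3_lincomb:
  "x *\<^sub>R sym3 a b c d e f + y *\<^sub>R sym3 a' b' c' d' e' f'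
    = sym3 (x*a + y*a') (x*b + y*b') (x*c + y*c') (x*d + y*d') (x*e + y*e') (x*f + y*f')"
  by (simp add: sym3_def vec_eq_iff forall_3)

lemma det_sym3: "det (sym3 a b c d e f) = a * d * f + 2 * b * c * e - a * e\<^sup>2 - d * c\<^sup>2 - f * b\<^sup>2"
  by (simp add: sym3_def det_3 power2_eq_square algebra_simps)

lemma no_double_rootD:
  assumes "no_double_root A B" "a * d - b * c \<noteq> 0"
    "\<And>x y. det (x *\<^sub>R (a *\<^sub>R A + b *\<^sub>R B) + y *\<^sub>R (c *\<^sub>R A + d *\<^sub>R B)) = y\<^sup>2 * (e * x + f * y)"
  shows False
  using assms unfolding no_double_root_def by blast

text \<open>Odd degree makes the determinant change sign between the opposite angles 0 and \<pi>, so
  the intermediate value theorem applies.\<close>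

lemma det_pencil_real_root:
  fixes A B :: "real^3^3"
  obtains \<theta> where "det (cos \<theta> *\<^sub>R A + sin \<theta> *\<^sub>R B) = 0"
proof -
  define g where "g t = det (cos t *\<^sub>R A + sin t *\<^sub>R B)" for t
  have cont: "continuous_on {0..pi} g"
    unfolding g_def det_3 by (intro continuous_intros)
  have "g pi = - g 0" by (simp add: g_def det_3 algebra_simps)
  then have "\<exists>t. 0 \<le> t \<and> t \<le> pi \<and> g t = 0"
    using IVT'[of g 0 0 pi] IVT2'[of g pi 0 0] cont pi_ge_zero by (cases "g 0 \<le> 0") force+
  then show ?thesis using that g_def by auto
qed

lemma transpose_congruence_lincomb:
  fixes A B M :: "real^3^3"
  assumes "transpose A = A" "transpose B = B"
  shows "transpose (transpose M ** (a *\<^sub>R A + b *\<^sub>R B) ** M) = transpose M ** (a *\<^sub>R A + b *\<^sub>R B) ** M"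
proof -
  have "transpose (a *\<^sub>R A + b *\<^sub>R B) = a *\<^sub>R transpose A + b *\<^sub>R transpose B"
    by (simp add: transpose_def vec_eq_iff)
  then show ?thesis by (simp add: assms matrix_transpose_mul matrix_mul_assoc)
qed

text \<open>Take a singular member \<open>C\<close> of the pencil and move a kernel vector to the
  first axis; by symmetry the first row and column of \<open>C\<close> vanish. Once the first axis
  is split off from the second member, the coefficient of \<open>x\<^sup>2 * y\<close> in the cubic
  is \<open>a * (p * r - q\<^sup>2)\<close>, and this is nonzero because the root is simple.\<close>

lemma pencil_block_form:
  assumes sym: "transpose A = A" "transpose B = B" and nd: "no_double_root A B"
  obtains p q r a d e f where "a \<noteq> 0" "p * r - q\<^sup>2 \<noteq> 0"
    "pencil_equiv A B (sym3 0 0 0 p q r) (sym3 a 0 0 d e f)"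
proof -
  obtain \<theta> where \<theta>: "det (cos \<theta> *\<^sub>R A + sin \<theta> *\<^sub>R B) = 0" (is "det ?C = 0")
    using det_pencil_real_root .
  \<comment> \<open>Rotating the pair by \<theta> completes the singular member to a basis of the
    pencil.\<close>
  let ?D = "- sin \<theta> *\<^sub>R A + cos \<theta> *\<^sub>R B"
  obtain v where v: "v \<noteq> 0" "?C *v v = 0"
    using \<theta> by (metis invertible_det_nz invertible_left_inverse matrix_left_invertible_ker)
  have "norm (v /\<^sub>R norm v) = 1" using v by simp
  then obtain M :: "real^3^3" where M: "orthogonal_matrix M" "M *v axis 1 1 = v /\<^sub>R norm v"
    using orthogonal_matrix_exists_basis by metis
  define C' where "C' = transpose M ** ?C ** M"
  define D' where "D' = transpose M ** ?D ** M"
  have symC: "transpose C' = C'" and symD: "transpose D' = D'"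
    unfolding C'_def D'_def by (rule transpose_congruence_lincomb[OF sym])+
  have "C' *v axis 1 1 = 0"
    by (simp add: C'_def M v matrix_vector_mul_assoc[symmetric] matrix_vector_mult_scaleR del: matrix_vector_mul_assoc)
  then have C0: "C'$i$1 = 0" for i
    by (simp add: matrix_vector_mult_basis column_def vec_eq_iff)
  have C0': "C'$1$i = 0" for i
    using C0 symmetric_entry[OF symC, of 1 i] by simp
  obtain p q r where C': "C' = sym3 0 0 0 p q r"
    using symmetric_eq_sym3[OF symC] unfolding C0' by (rule that)
  obtain a b c d e f where D': "D' = sym3 a b c d e f"
    using symmetric_eq_sym3[OF symD] by (rule that)
  have eq1: "pencil_equiv A B C' D'"
  proof (rule pencil_equiv_I)
    show "det M \<noteq> 0" using M det_orthogonal_matrix by force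
    show "cos \<theta> * cos \<theta> - sin \<theta> * - sin \<theta> \<noteq> 0"
      using sin_cos_squared_add3[of \<theta>] by simp
  qed (simp_all only: C'_def D'_def)
  have nd1: "no_double_root C' D'" using no_double_root_pencil_equiv[OF eq1 nd] .
  have a: "a \<noteq> 0"
  proof
    assume "a = 0"
    \<comment> \<open>With \<open>a = 0\<close>, the first row and column of
      \<open>x C' + y D'\<close> are multiples of \<open>y\<close> with zero corner, so
      \<open>y\<^sup>2\<close> divides the determinant. The instantiation lists \<open>a\<close>,
      \<open>d\<close>, \<open>b\<close>, \<open>c\<close> in this order, so it is the identity
      change of basis.\<close>
    show False
    proof (rule no_double_rootD[OF nd1, of 1 1 0 0])
      fix x y
      show "det (x *\<^sub>R (1 *\<^sub>R C' + 0 *\<^sub>R D') + y *\<^sub>R (0 *\<^sub>R C' + 1 *\<^sub>R D'))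
        = y\<^sup>2 * ((2*b*c*q - p*c\<^sup>2 - r*b\<^sup>2) * x + (2*b*c*e - d*c\<^sup>2 - f*b\<^sup>2) * y)"
        by (simp add: C' D' sym3_lincomb det_sym3 \<open>a = 0\<close>) (simp add: power2_eq_square algebra_simps)
    qed simp
  qed
  \<comment> \<open>Completing the square in the first variable clears \<open>b\<close> and
    \<open>c\<close> from \<open>D'\<close>; it fixes \<open>C'\<close>, whose first row and column
    are zero.\<close>
  define N :: "real^3^3" where "N = vector [vector [1, -b/a, -c/a], vector [0,1,0], vector [0,0,1]]"
  obtain d' e' f' where eq2: "pencil_equiv C' D' (sym3 0 0 0 p q r) (sym3 a 0 0 d' e' f')"
  proof
    show "pencil_equiv C' D' (sym3 0 0 0 p q r)
        (sym3 a 0 0 (d - b\<^sup>2/a) (e - b*c/a) (f - c\<^sup>2/a))"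
      by (rule pencil_equiv_I[of N 1 1 0 0])
         (use a in \<open>simp_all add: N_def C' D' sym3_lincomb det_3\<close>,
          simp_all add: sym3_def matrix3_entrywise
            power2_eq_square field_simps)
  qed
  have nd2: "no_double_root (sym3 0 0 0 p q r) (sym3 a 0 0 d' e' f')"
    using no_double_root_pencil_equiv[OF eq2 nd1] .
  have "p * r - q\<^sup>2 \<noteq> 0"
  proof
    assume "p * r - q\<^sup>2 = 0"
    then have q: "q\<^sup>2 = p * r" by simp
    show False
    proof (rule no_double_rootD[OF nd2, of 1 1 0 0])
      fix x y
      have "det (x *\<^sub>R (1 *\<^sub>R sym3 0 0 0 p q r + 0 *\<^sub>R sym3 a 0 0 d' e' f')
            + y *\<^sub>R (0 *\<^sub>R sym3 0 0 0 p q r + 1 *\<^sub>R sym3 a 0 0 d' e' f'))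
        = y\<^sup>2 * (a * (p * f' + r * d' - 2 * q * e') * x + a * (d' * f' - e'\<^sup>2) * y)
          + a * x\<^sup>2 * y * (p * r - q\<^sup>2)"
        by (simp add: sym3_lincomb det_sym3) (simp add: power2_eq_square algebra_simps)
      then show "det (x *\<^sub>R (1 *\<^sub>R sym3 0 0 0 p q r + 0 *\<^sub>R sym3 a 0 0 d' e' f')
            + y *\<^sub>R (0 *\<^sub>R sym3 0 0 0 p q r + 1 *\<^sub>R sym3 a 0 0 d' e' f'))
        = y\<^sup>2 * (a * (p * f' + r * d' - 2 * q * e') * x + a * (d' * f' - e'\<^sup>2) * y)"
        by (simp add: q)
    qed simp
  qed
  then show ?thesis using that a pencil_equiv_trans[OF eq1 eq2] by blast
qed

section \<open>Normal forms of the 2x2 blocks\<close>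

text \<open>A binary quadratic form of rank at most one is a multiple of the square of a linear
  form.\<close>

lemma singular_symmetric_2x2:
  fixes p q r :: real
  assumes "p * r = q\<^sup>2"
  obtains s u v where "p = s * u\<^sup>2" "q = s * u * v" "r = s * v\<^sup>2"
proof (cases "p = 0")
  case True
  with assms show ?thesis using that[of r 0 1] by simp
next
  case False
  with assms show ?thesis using that[of "1/p" p q] by (simp add: power2_eq_square field_simps)
qed

text \<open>An indefinite binary form splits over the reals as
  \<open>(u x + v y) (u' x + v' y)\<close> with independent factors, read off from the quadratic
  formula. The witnesses are passed in the order \<open>u\<close>, \<open>u'\<close>,
  \<open>v'\<close>, \<open>v\<close>.\<close>

lemma indefinite_2x2_factor:
  fixes p q r :: real
  assumes "p * r - q\<^sup>2 < 0"
  obtains u v u' v' where "p = u * u'" "2 * q = u * v' + u' * v" "r = v * v'" "u * v' - u' * v \<noteq> 0"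
proof (cases "p = 0")
  case True
  with assms show ?thesis using that[of 0 "2 * q" r 1] by simp
next
  case False
  define w where "w = sqrt (q\<^sup>2 - p * r)"
  have w: "w\<^sup>2 = q\<^sup>2 - p * r" "w \<noteq> 0" using assms by (auto simp: w_def)
  have "(q + w) / p * (q - w) = r"
    using w(1) False by (simp add: field_simps power2_eq_square)
  with False w show ?thesis
    using that[of 1 p "q - w" "(q + w) / p"] by simp
qed

lemma mult_square_eq_sgn:
  fixes x :: real
  assumes "x \<noteq> 0"
  obtains k where "k \<noteq> 0" "x * k\<^sup>2 = sgn x"
  using assms that[of "1 / sqrt \<bar>x\<bar>"] by (simp add: power_divide real_sgn_eq)

text \<open>The difference of the two members loses its first entry and becomes a multiple of the
  first normal form; the first member gives the second. Scaling the first and third variables then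
  turns the coefficients into signs.\<close>

lemma pencil_equiv_diagonal:
  assumes "a \<noteq> 0" "x \<noteq> 0" "y \<noteq> 0"
  obtains s t where "s \<in> {1, -1}" "t \<in> {1, -1}"
    "pencil_equiv (sym3 a 0 0 x 0 0) (sym3 a 0 0 0 0 y) (sym3 0 0 0 1 0 s) (sym3 1 0 0 t 0 0)"
proof -
  define s t where "s = sgn (- y / x)" and "t = sgn (a / x)"
  obtain k where k: "k \<noteq> 0" "a / x * k\<^sup>2 = t"
    using mult_square_eq_sgn[of "a / x"] assms unfolding t_def by auto
  obtain l where l: "l \<noteq> 0" "- y / x * l\<^sup>2 = s"
    using mult_square_eq_sgn[of "- y / x"] assms unfolding s_def by auto
  have t: "t \<in> {1, -1}" and s: "s \<in> {1, -1}" using assms by (auto simp: s_def t_def sgn_if)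
  define M :: "real^3^3" where "M = vector [vector [k,0,0], vector [0,1,0], vector [0,0,l]]"
  have tt: "t * (a / x * k\<^sup>2) = 1" using t k by auto
  have "pencil_equiv (sym3 a 0 0 x 0 0) (sym3 a 0 0 0 0 y) (sym3 0 0 0 1 0 s) (sym3 1 0 0 t 0 0)"
  proof (rule pencil_equiv_I)
    show "det M \<noteq> 0" using k l by (simp add: M_def det_3)
    show "1 / x * 0 - (- 1 / x) * (t / x) \<noteq> 0" using assms t by auto
    show "transpose M ** ((1 / x) *\<^sub>R sym3 a 0 0 x 0 0 + (- 1 / x) *\<^sub>R sym3 a 0 0 0 0 y) ** M = sym3 0 0 0 1 0 s"
      using l(2) assms
      by (simp add: M_def sym3_lincomb)
         (simp add: sym3_def matrix3_entrywise power2_eq_square mult_ac)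
    show "transpose M ** ((t / x) *\<^sub>R sym3 a 0 0 x 0 0 + 0 *\<^sub>R sym3 a 0 0 0 0 y) ** M = sym3 1 0 0 t 0 0"
      using tt assms
      by (simp only: M_def sym3_lincomb)
         (simp add: sym3_def matrix3_entrywise power2_eq_square mult_ac)
  qed
  with s t show ?thesis using that by blast
qed

text \<open>A multiple of the first matrix removes \<open>e\<close> from the second, and
  multiplication by the sign of \<open>a\<close> makes the leading entry positive. The other two
  diagonal entries have opposite signs, and the variables are rescaled.\<close>

lemma pencil_equiv_hyperbolic:
  assumes "a \<noteq> 0" "h \<noteq> 0" "d * f < 0"
  shows "pencil_equiv (sym3 0 0 0 0 h 0) (sym3 a 0 0 d e f) (sym3 0 0 0 0 (1/2) 0) (sym3 1 0 0 1 0 (-1))"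
proof -
  define \<sigma> where "\<sigma> = sgn a"
  have df: "d \<noteq> 0" "f \<noteq> 0" using assms(3) by auto
  obtain k where k: "k \<noteq> 0" "a * k\<^sup>2 = sgn a" using mult_square_eq_sgn assms by blast
  obtain l where l: "l \<noteq> 0" "f * l\<^sup>2 = sgn f" using mult_square_eq_sgn df by blast
  obtain m where m: "m \<noteq> 0" "d * m\<^sup>2 = sgn d" using mult_square_eq_sgn df by blast
  have \<sigma>: "\<sigma> * (a * k\<^sup>2) = 1" "\<sigma> \<noteq> 0" unfolding k \<sigma>_def using assms by (auto simp: sgn_if)
  have "\<sigma> * (d * m\<^sup>2) = 1 \<and> \<sigma> * (f * l\<^sup>2) = -1 \<or> \<sigma> * (d * m\<^sup>2) = -1 \<and> \<sigma> * (f * l\<^sup>2) = 1"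
    unfolding l m \<sigma>_def using assms by (auto simp: sgn_if mult_less_0_iff)
  then consider "\<sigma> * (d * m\<^sup>2) = 1" "\<sigma> * (f * l\<^sup>2) = -1" | "\<sigma> * (d * m\<^sup>2) = -1" "\<sigma> * (f * l\<^sup>2) = 1"
    by blast
  then show ?thesis
  proof cases
    case 1
    define M :: "real^3^3" where "M = vector [vector [k,0,0], vector [0,m,0], vector [0,0,l]]"
    show ?thesis
    proof (rule pencil_equiv_I)
      show "det M \<noteq> 0" using k l m by (simp add: M_def det_3)
      show "1 / (2 * h * l * m) * \<sigma> - 0 * (- \<sigma> * e / h) \<noteq> 0" using assms l m \<sigma> by auto
      show "transpose M ** ((1 / (2 * h * l * m)) *\<^sub>R sym3 0 0 0 0 h 0 + 0 *\<^sub>R sym3 a 0 0 d e f) ** M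
          = sym3 0 0 0 0 (1/2) 0"
        using assms l m
        by (simp only: M_def sym3_lincomb)
           (simp add: sym3_def matrix3_entrywise power2_eq_square mult_ac)
      show "transpose M ** ((- \<sigma> * e / h) *\<^sub>R sym3 0 0 0 0 h 0 + \<sigma> *\<^sub>R sym3 a 0 0 d e f) ** M
          = sym3 1 0 0 1 0 (-1)"
        using assms \<sigma> 1
        by (simp only: M_def sym3_lincomb)
           (simp add: sym3_def matrix3_entrywise power2_eq_square mult_ac)
    qed
  next
    case 2
    \<comment> \<open>Here the signs come in the wrong order, so \<open>M\<close> also swaps the
      last two variables.\<close>
    define M :: "real^3^3" where "M = vector [vector [k,0,0], vector [0,0,m], vector [0,l,0]]"
    show ?thesis
    proof (rule pencil_equiv_I)
      show "det M \<noteq> 0" using k l m by (simp add: M_def det_3)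
      show "1 / (2 * h * l * m) * \<sigma> - 0 * (- \<sigma> * e / h) \<noteq> 0" using assms l m \<sigma> by auto
      show "transpose M ** ((1 / (2 * h * l * m)) *\<^sub>R sym3 0 0 0 0 h 0 + 0 *\<^sub>R sym3 a 0 0 d e f) ** M
          = sym3 0 0 0 0 (1/2) 0"
        using assms l m
        by (simp only: M_def sym3_lincomb)
           (simp add: sym3_def matrix3_entrywise power2_eq_square mult_ac)
      show "transpose M ** ((- \<sigma> * e / h) *\<^sub>R sym3 0 0 0 0 h 0 + \<sigma> *\<^sub>R sym3 a 0 0 d e f) ** M
          = sym3 1 0 0 1 0 (-1)"
        using assms \<sigma> 2
        by (simp only: M_def sym3_lincomb)
           (simp add: sym3_def matrix3_entrywise power2_eq_square mult_ac)
    qed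
  qed
qed

text \<open>The lower block of \<open>t C + D\<close> has determinant
  \<open>K * t\<^sup>2 + m * t + n\<close>; the three cases are the signs of its discriminant
  \<delta>.\<close>

lemma pencil_equiv_normal_form:
  assumes nd: "no_double_root (sym3 0 0 0 p q r) (sym3 a 0 0 d e f)" (is "no_double_root ?C ?D")
    and a: "a \<noteq> 0" and K: "p * r - q\<^sup>2 \<noteq> 0"
  shows "(\<exists>s\<in>{1, -1}. \<exists>t\<in>{1, -1}. pencil_equiv ?C ?D (sym3 0 0 0 1 0 s) (sym3 1 0 0 t 0 0))
       \<or> pencil_equiv ?C ?D (sym3 0 0 0 0 (1/2) 0) (sym3 1 0 0 1 0 (-1))"
proof -
  define K where "K = p * r - q\<^sup>2"
  define m where "m = p * f + r * d - 2 * q * e"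
  define n where "n = d * f - e\<^sup>2"
  define \<delta> where "\<delta> = m\<^sup>2 - 4 * K * n"
  have K0: "K \<noteq> 0" using K by (simp add: K_def)
  have det_eq: "(t * p + d) * (t * r + f) - (t * q + e)\<^sup>2 = K * t\<^sup>2 + m * t + n" for t
    by (simp add: K_def m_def n_def power2_eq_square algebra_simps)
  consider "\<delta> = 0" | "\<delta> > 0" | "\<delta> < 0" by linarith
  then show ?thesis
  proof cases
    case 1
    \<comment> \<open>\<open>\<tau> C + D\<close> is a double zero of the determinant.\<close>
    define \<tau> where "\<tau> = - m / (2 * K)"
    have 2: "m = - 2 * K * \<tau>" using K0 by (simp add: \<tau>_def)
    have 3: "n = K * \<tau>\<^sup>2"
    proof -
      have "4 * K * n = m\<^sup>2" using 1 by (simp add: \<delta>_def)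
      also have "\<dots> = 4 * K * (K * \<tau>\<^sup>2)" unfolding 2 by (simp add: power2_eq_square)
      finally have "4 * K * n = 4 * K * (K * \<tau>\<^sup>2)" .
      then show ?thesis using K0 unfolding mult_cancel_left by auto
    qed
    have False
    proof (rule no_double_rootD[OF nd, of \<tau> 0 1 1])
      fix x y
      have "det (x *\<^sub>R (\<tau> *\<^sub>R ?C + 1 *\<^sub>R ?D) + y *\<^sub>R (1 *\<^sub>R ?C + 0 *\<^sub>R ?D))
          = a * x * (K * (x * \<tau> + y)\<^sup>2 + m * (x * \<tau> + y) * x + n * x\<^sup>2)"
        unfolding K_def m_def n_def sym3_lincomb det_sym3
        by (simp add: power2_eq_square algebra_simps)
      \<comment> \<open>With these values of \<open>m\<close> and \<open>n\<close> the bracket is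
        the perfect square \<open>K * ((x * \<tau> + y) - \<tau> * x)\<^sup>2\<close>.\<close>
      also have "\<dots> = y\<^sup>2 * (a * K * x + 0 * y)"
        unfolding 2 3 by (simp add: power2_eq_square algebra_simps)
      finally show "det (x *\<^sub>R (\<tau> *\<^sub>R ?C + 1 *\<^sub>R ?D) + y *\<^sub>R (1 *\<^sub>R ?C + 0 *\<^sub>R ?D))
          = y\<^sup>2 * (a * K * x + 0 * y)" .
    qed simp
    then show ?thesis ..
  next
    case 2
    \<comment> \<open>The lower blocks of \<open>t\<^sub>i C + D\<close> have rank one; their linear factors are the new coordinates.\<close>
    obtain t\<^sub>1 t\<^sub>2 where t: "t\<^sub>1 - t\<^sub>2 \<noteq> 0"
      and root: "K * t\<^sub>1\<^sup>2 + m * t\<^sub>1 + n = 0" "K * t\<^sub>2\<^sup>2 + m * t\<^sub>2 + n = 0"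
      using discriminant_pos_ex[OF K0, of m n] 2 by (auto simp: discrim_def \<delta>_def)
    obtain s\<^sub>1 u\<^sub>1 v\<^sub>1 where 1: "t\<^sub>1 * p + d = s\<^sub>1 * u\<^sub>1\<^sup>2" "t\<^sub>1 * q + e = s\<^sub>1 * u\<^sub>1 * v\<^sub>1" "t\<^sub>1 * r + f = s\<^sub>1 * v\<^sub>1\<^sup>2"
      using singular_symmetric_2x2[of "t\<^sub>1 * p + d" "t\<^sub>1 * r + f" "t\<^sub>1 * q + e"] det_eq[of t\<^sub>1] root by auto
    obtain s\<^sub>2 u\<^sub>2 v\<^sub>2 where 2: "t\<^sub>2 * p + d = s\<^sub>2 * u\<^sub>2\<^sup>2" "t\<^sub>2 * q + e = s\<^sub>2 * u\<^sub>2 * v\<^sub>2" "t\<^sub>2 * r + f = s\<^sub>2 * v\<^sub>2\<^sup>2"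
      using singular_symmetric_2x2[of "t\<^sub>2 * p + d" "t\<^sub>2 * r + f" "t\<^sub>2 * q + e"] det_eq[of t\<^sub>2] root by auto
    define \<Delta> where "\<Delta> = u\<^sub>1 * v\<^sub>2 - u\<^sub>2 * v\<^sub>1"
    \<comment> \<open>Both sides are the determinant of the difference of the two rank one blocks,
      which is \<open>t\<^sub>1 - t\<^sub>2\<close> times the block of \<open>C\<close>. It shows
      that the multipliers are nonzero and the linear forms independent.\<close>
    have "K * (t\<^sub>1 - t\<^sub>2)\<^sup>2 = ((t\<^sub>1 * p + d) - (t\<^sub>2 * p + d)) * ((t\<^sub>1 * r + f) - (t\<^sub>2 * r + f))
        - ((t\<^sub>1 * q + e) - (t\<^sub>2 * q + e))\<^sup>2"
      by (simp add: K_def power2_eq_square algebra_simps)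
    also have "\<dots> = - s\<^sub>1 * s\<^sub>2 * \<Delta>\<^sup>2"
      unfolding 1 2 \<Delta>_def by (simp add: power2_eq_square algebra_simps)
    finally have "s\<^sub>1 * s\<^sub>2 * \<Delta>\<^sup>2 \<noteq> 0" using K0 t by auto
    then have nz: "s\<^sub>1 * \<Delta>\<^sup>2 \<noteq> 0" "s\<^sub>2 * \<Delta>\<^sup>2 \<noteq> 0" "\<Delta> \<noteq> 0" by auto
    \<comment> \<open>The lower block is the adjugate of the matrix of the two linear forms, so they
      become \<Delta> times the coordinates.\<close>
    define M :: "real^3^3" where "M = vector [vector [1,0,0], vector [0,v\<^sub>2,-v\<^sub>1], vector [0,-u\<^sub>2,u\<^sub>1]]"
    have "pencil_equiv ?C ?D (sym3 a 0 0 (s\<^sub>1 * \<Delta>\<^sup>2) 0 0) (sym3 a 0 0 0 0 (s\<^sub>2 * \<Delta>\<^sup>2))"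
    proof (rule pencil_equiv_I)
      show "det M \<noteq> 0" using nz by (simp add: M_def det_3 \<Delta>_def mult_ac)
      show "t\<^sub>1 * 1 - 1 * t\<^sub>2 \<noteq> 0" using t by simp
      show "transpose M ** (t\<^sub>1 *\<^sub>R ?C + 1 *\<^sub>R ?D) ** M = sym3 a 0 0 (s\<^sub>1 * \<Delta>\<^sup>2) 0 0"
        by (simp only: M_def sym3_lincomb mult_1 1 \<Delta>_def)
           (simp add: sym3_def matrix3_entrywise
             power2_eq_square algebra_simps)
      show "transpose M ** (t\<^sub>2 *\<^sub>R ?C + 1 *\<^sub>R ?D) ** M = sym3 a 0 0 0 0 (s\<^sub>2 * \<Delta>\<^sup>2)"
        by (simp only: M_def sym3_lincomb mult_1 2 \<Delta>_def)
           (simp add: sym3_def matrix3_entrywise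
             power2_eq_square algebra_simps)
    qed
    moreover obtain s t where "s \<in> {1, -1}" "t \<in> {1, -1}"
      "pencil_equiv (sym3 a 0 0 (s\<^sub>1 * \<Delta>\<^sup>2) 0 0) (sym3 a 0 0 0 0 (s\<^sub>2 * \<Delta>\<^sup>2)) (sym3 0 0 0 1 0 s) (sym3 1 0 0 t 0 0)"
      using pencil_equiv_diagonal[OF a nz(1,2)] .
    ultimately show ?thesis using pencil_equiv_trans by blast
  next
    case 3
    \<comment> \<open>The lower block of \<open>C\<close> is indefinite, since a definite one would be diagonalisable together
      with that of \<open>D\<close>, making \<open>\<delta>\<close> nonnegative.\<close>
    have "K < 0"
    proof (rule ccontr)
      assume "\<not> K < 0"
      with K0 have "K > 0" by simp
      then have p: "p \<noteq> 0" by (auto simp: K_def)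
      \<comment> \<open>The shear by \<open>c\<close> diagonalises the block of \<open>C\<close>; in
        the sheared coordinates \<delta> is a square plus \<open>4 * K\<close> times a
        square.\<close>
      define c where "c = q / p"
      have q: "q = c * p" using p by (simp add: c_def)
      have "\<delta> = (p * (f - 2 * c * e + c\<^sup>2 * d) - (r - c\<^sup>2 * p) * d)\<^sup>2 + 4 * K * (e - c * d)\<^sup>2"
        unfolding \<delta>_def K_def m_def n_def q by (simp add: power2_eq_square algebra_simps)
      also have "\<dots> \<ge> 0" using \<open>K > 0\<close> by simp
      finally show False using 3 by simp
    qed
    then obtain u v u' v' where f: "p = u * u'" "2 * q = u * v' + u' * v" "r = v * v'" "u * v' - u' * v \<noteq> 0"
      using indefinite_2x2_factor K_def by metis
    have q: "q = (u * v' + u' * v) / 2" using f(2) by simp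
    define \<Delta> where "\<Delta> = u * v' - u' * v"
    \<comment> \<open>The adjugate again: the two factors of the block of \<open>C\<close> become
      \<Delta> times the coordinates.\<close>
    define M :: "real^3^3" where "M = vector [vector [1,0,0], vector [0,v',-v], vector [0,-u',u]]"
    define d' e' f' where "d' = d * v'\<^sup>2 - 2 * e * u' * v' + f * u'\<^sup>2"
      and "e' = - d * v * v' + e * (u * v' + u' * v) - f * u * u'"
      and "f' = d * v\<^sup>2 - 2 * e * u * v + f * u\<^sup>2"
    \<comment> \<open>\<open>d'\<close> and \<open>f'\<close> are the values of the block form of
      \<open>D\<close> on the two null directions of that of \<open>C\<close>, so their product is
      the resultant of the two forms.\<close>
    have "d' * f' = \<delta>"
      unfolding d'_def f'_def \<delta>_def K_def m_def n_def f(1,3) q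
      by (simp add: power2_eq_square field_simps)
    with 3 have df: "d' * f' < 0" by simp
    have "pencil_equiv ?C ?D (sym3 0 0 0 0 (\<Delta>\<^sup>2 / 2) 0) (sym3 a 0 0 d' e' f')"
    proof (rule pencil_equiv_I)
      show "det M \<noteq> 0" using f(4) by (simp add: M_def det_3 mult_ac)
      show "1 * 1 - 0 * 0 \<noteq> (0::real)" by simp
      show "transpose M ** (1 *\<^sub>R ?C + 0 *\<^sub>R ?D) ** M = sym3 0 0 0 0 (\<Delta>\<^sup>2 / 2) 0"
        by (simp add: M_def sym3_lincomb f(1,3) q \<Delta>_def)
           (simp add: sym3_def matrix3_entrywise
             power2_eq_square field_simps)
      show "transpose M ** (0 *\<^sub>R ?C + 1 *\<^sub>R ?D) ** M = sym3 a 0 0 d' e' f'"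
        by (simp add: M_def sym3_lincomb d'_def e'_def f'_def)
           (simp add: sym3_def matrix3_entrywise
             power2_eq_square algebra_simps)
    qed
    moreover have "pencil_equiv (sym3 0 0 0 0 (\<Delta>\<^sup>2 / 2) 0) (sym3 a 0 0 d' e' f')
        (sym3 0 0 0 0 (1/2) 0) (sym3 1 0 0 1 0 (-1))"
      using pencil_equiv_hyperbolic[OF a _ df] f(4) by (simp add: \<Delta>_def)
    ultimately show ?thesis using pencil_equiv_trans by blast
  qed
qed

section \<open>From matrices back to quadratic forms\<close>

lemma quad_form_congruence_lincomb:
  "quad_form (transpose M ** (a *\<^sub>R A + b *\<^sub>R B) ** M) \<xi> = a * quad_form A (M *v \<xi>) + b * quad_form B (M *v \<xi>)"
proof -
  have "quad_form (transpose M ** (a *\<^sub>R A + b *\<^sub>R B) ** M) \<xi>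
      = \<xi> \<bullet> (transpose M *v ((a *\<^sub>R A + b *\<^sub>R B) *v (M *v \<xi>)))"
    by (simp only: quad_form_def matrix_vector_mul_assoc matrix_mul_assoc)
  also have "\<dots> = (M *v \<xi>) \<bullet> ((a *\<^sub>R A + b *\<^sub>R B) *v (M *v \<xi>))"
    by (metis dot_lmul_matrix inner_commute transpose_matrix_vector transpose_transpose)
  also have "(a *\<^sub>R A + b *\<^sub>R B) *v (M *v \<xi>) = a *\<^sub>R (A *v (M *v \<xi>)) + b *\<^sub>R (B *v (M *v \<xi>))"
    by (simp only: matrix_vector_mult_add_rdistrib scaleR_matrix_vector_assoc)
  finally show ?thesis by (simp add: quad_form_def inner_add_right)
qed

lemma pencil_equiv_imp_equivalent_forms:
  assumes "irreducible_pair A B" "irreducible_pair A' B'" "pencil_equiv A B A' B'"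
  shows "equivalent_forms (quad_form A) (quad_form B) (quad_form A') (quad_form B')"
proof -
  obtain M a b c d where M: "invertible M" "a * d - b * c \<noteq> 0"
      "A' = transpose M ** (a *\<^sub>R A + b *\<^sub>R B) ** M" "B' = transpose M ** (c *\<^sub>R A + d *\<^sub>R B) ** M"
    using assms(3) unfolding pencil_equiv_def by blast
  define N :: "real^2^2" where "N = vector [vector [a, b], vector [c, d]]"
  have "invertible N" using M(2) by (simp add: invertible_det_nz N_def det_2)
  moreover have "(vector [quad_form A' \<xi>, quad_form B' \<xi>] :: real^2)
      = N *v vector [quad_form A (M *v \<xi>), quad_form B (M *v \<xi>)]" for \<xi>
    by (simp add: M quad_form_congruence_lincomb N_def vec_eq_iff forall_2 matrix_vector_mult_def sum_2)
  ultimately show ?thesis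
    using assms M(1) unfolding equivalent_forms_def equivalent_pairs_def by blast
qed

lemma quad_form_sym3:
  "quad_form (sym3 a b c d e f) \<xi> = a * (\<xi>$1)\<^sup>2 + d * (\<xi>$2)\<^sup>2 + f * (\<xi>$3)\<^sup>2
     + 2 * b * \<xi>$1 * \<xi>$2 + 2 * c * \<xi>$1 * \<xi>$3 + 2 * e * \<xi>$2 * \<xi>$3"
  by (simp add: quad_form_def sym3_def inner_vec_def matrix_vector_mult_def sum_3 power2_eq_square algebra_simps)

lemma irreducible_pair_I:
  assumes "transpose A = A" "transpose B = B" "B \<noteq> 0" "\<And>k. A \<noteq> k *\<^sub>R B"
    "\<And>x. A *v x = 0 \<Longrightarrow> B *v x = 0 \<Longrightarrow> x = 0"
  shows "irreducible_pair A B"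
proof -
  have "A \<notin> span {B}" using assms(4) by (auto simp: span_singleton)
  moreover have "A \<noteq> B" using assms(4)[of 1] by simp
  ultimately have "independent {A, B}"
    using assms(3) by (simp add: independent_insert)
  with \<open>A \<noteq> B\<close> assms show ?thesis unfolding irreducible_pair_def by auto
qed

text \<open>Equivalence is defined only between irreducible pairs, so the normal forms have to be
  checked as well.\<close>

lemma irreducible_pair_diagonal:
  assumes "s \<noteq> 0" "t \<noteq> 0"
  shows "irreducible_pair (sym3 0 0 0 1 0 s) (sym3 1 0 0 t 0 0)"
  using assms
  by (intro irreducible_pair_I)
     (auto simp: sym3_def vec_eq_iff forall_3 transpose_def matrix_vector_mult_def sum_3)

lemma irreducible_pair_hyperbolic:
  "irreducible_pair (sym3 0 0 0 0 (1/2) 0) (sym3 1 0 0 1 0 (-1))"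
  by (intro irreducible_pair_I)
     (auto simp: sym3_def vec_eq_iff forall_3 transpose_def matrix_vector_mult_def sum_3)

theorem theorem1p1:
  fixes A B :: "real^3^3"
  assumes "transpose A = A" and "transpose B = B"
    and "irreducible_pair A B"
    and "CM_condition A B"
  shows "(\<exists>s\<in>{1, -1}. \<exists>t\<in>{1, -1}.
            equivalent_forms (quad_form A) (quad_form B)
              (\<lambda>\<xi>. (\<xi>$2)^2 + s * (\<xi>$3)^2) (\<lambda>\<xi>. (\<xi>$1)^2 + t * (\<xi>$2)^2))
       \<or> equivalent_forms (quad_form A) (quad_form B)
              (\<lambda>\<xi>. \<xi>$2 * \<xi>$3) (\<lambda>\<xi>. (\<xi>$1)^2 + (\<xi>$2)^2 - (\<xi>$3)^2)"
proof -
  have nd: "no_double_root A B" using assms(4) by (rule CM_condition_imp_no_double_root)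
  obtain p q r a d e f where block: "a \<noteq> 0" "p * r - q\<^sup>2 \<noteq> 0"
    "pencil_equiv A B (sym3 0 0 0 p q r) (sym3 a 0 0 d e f)"
    using pencil_block_form[OF assms(1,2) nd] .
  have "(\<exists>s\<in>{1, -1}. \<exists>t\<in>{1, -1}. pencil_equiv A B (sym3 0 0 0 1 0 s) (sym3 1 0 0 t 0 0))
       \<or> pencil_equiv A B (sym3 0 0 0 0 (1/2) 0) (sym3 1 0 0 1 0 (-1))"
    using pencil_equiv_normal_form[OF no_double_root_pencil_equiv[OF block(3) nd] block(1,2)]
      pencil_equiv_trans[OF block(3)] by blast
  then show ?thesis
  proof
    assume "\<exists>s\<in>{1, -1}. \<exists>t\<in>{1, -1}. pencil_equiv A B (sym3 0 0 0 1 0 s) (sym3 1 0 0 t 0 0)"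
    then obtain s t where st: "s \<in> {1, -1}" "t \<in> {1, -1}"
      "pencil_equiv A B (sym3 0 0 0 1 0 s) (sym3 1 0 0 t 0 0)" by blast
    have "quad_form (sym3 0 0 0 1 0 s) = (\<lambda>\<xi>. (\<xi>$2)^2 + s * (\<xi>$3)^2)"
      "quad_form (sym3 1 0 0 t 0 0) = (\<lambda>\<xi>. (\<xi>$1)^2 + t * (\<xi>$2)^2)"
      by (simp_all add: fun_eq_iff quad_form_sym3)
    moreover have "irreducible_pair (sym3 0 0 0 1 0 s) (sym3 1 0 0 t 0 0)"
      using st by (intro irreducible_pair_diagonal) auto
    ultimately have "equivalent_forms (quad_form A) (quad_form B)
        (\<lambda>\<xi>. (\<xi>$2)^2 + s * (\<xi>$3)^2) (\<lambda>\<xi>. (\<xi>$1)^2 + t * (\<xi>$2)^2)"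
      using pencil_equiv_imp_equivalent_forms[OF assms(3) _ st(3)] by simp
    with st(1,2) show ?thesis by blast
  next
    assume hyp: "pencil_equiv A B (sym3 0 0 0 0 (1/2) 0) (sym3 1 0 0 1 0 (-1))"
    \<comment> \<open>The off-diagonal entry enters the form twice, hence the factor
      \<open>1/2\<close>.\<close>
    have "quad_form (sym3 0 0 0 0 (1/2) 0) = (\<lambda>\<xi>. \<xi>$2 * \<xi>$3)"
      "quad_form (sym3 1 0 0 1 0 (-1)) = (\<lambda>\<xi>. (\<xi>$1)^2 + (\<xi>$2)^2 - (\<xi>$3)^2)"
      by (simp_all add: fun_eq_iff quad_form_sym3)
    then show ?thesis
      using pencil_equiv_imp_equivalent_forms[OF assms(3) irreducible_pair_hyperbolic hyp] by simp
  qed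
qed

end
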